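(* Fix a target label $y_c$ and let $a_1(y_c),\dots,a_N(y_c)\ge 0$ be unnormalized vicinity weights with $A(y_c)=\sum_{i=1}^N a_i(y_c)>0$. Let $\bar W_i(y_c)=a_i(y_c)/A(y_c)$ and $$N_{\mathrm{eff}}(y_c;a)=\frac{1}{\sum_{i=1}^N \bar W_i^2(y_c)}.$$ Let $\ell_1(y_c),\dots,\ell_N(y_c)$ be real-valued random variables and $\widehat L_D(y_c)=\sum_{i=1}^N \bar W_i(y_c)\,\ell_i(y_c)$. Conditioned on $y_c$ and the normalized weights $\bar W_i(y_c)$, assume that the terms $\ell_i(y_c)$ are independent and have finite variance. Then, with variances taken under this conditioning, $$\mathrm{Var}\left[\widehat L_D(y_c)\right]\le\frac{\max_{i}\mathrm{Var}[\ell_i(y_c)]}{N_{\mathrm{eff}}(y_c;a)}.$$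
   Context: $N_{\mathrm{eff}}(y_c;a)$ is called the effective sample size; equivalently $N_{\mathrm{eff}}(y_c;a)=\left(\sum_i a_i(y_c)\right)^2/\sum_i a_i^2(y_c)$. The variable $\ell_i(y_c)$ represents the scalar per-sample adversarial loss term of the $i$-th sample in one (real or fake) branch of a discriminator objective, with all network parameters held fixed. Because everything is conditioned on $y_c$ and the weights, $y_c$ and the $\bar W_i(y_c)$ may be treated as deterministic constants, and all variances are variances under that conditional law. *)

theory Defs
  imports "HOL-Probability.Probability"
begin

(* Unnormalized vicinity weights are given as a :: nat => 'y => real, where a i y is the
   weight of sample i (i = 1..N) with respect to the label y.  Everything is conditioned on the
   target label and on the weights, so weights are constants rather than random variables. *)

definition vic_norm_weight :: "nat \<Rightarrow> (nat \<Rightarrow> 'y \<Rightarrow> real) \<Rightarrow> 'y \<Rightarrow> nat \<Rightarrow> real" where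
  "vic_norm_weight N a y i = a i y / (\<Sum>j=1..N. a j y)"

definition eff_sample_size :: "nat \<Rightarrow> (nat \<Rightarrow> 'y \<Rightarrow> real) \<Rightarrow> 'y \<Rightarrow> real" where
  "eff_sample_size N a y = 1 / (\<Sum>i=1..N. (vic_norm_weight N a y i)\<^sup>2)"

definition weighted_loss ::
    "nat \<Rightarrow> (nat \<Rightarrow> 'y \<Rightarrow> real) \<Rightarrow> (nat \<Rightarrow> 'y \<Rightarrow> 'w \<Rightarrow> real) \<Rightarrow> 'y \<Rightarrow> 'w \<Rightarrow> real" where
  "weighted_loss N a l y \<omega> = (\<Sum>i=1..N. vic_norm_weight N a y i * l i y \<omega>)"

(* The integrability conjuncts matter: the Bochner integral of a non-integrable function is 0,
   so the value of the variance alone cannot express finiteness. *)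
definition has_finite_variance :: "'w measure \<Rightarrow> ('w \<Rightarrow> real) \<Rightarrow> bool" where
  "has_finite_variance M X \<longleftrightarrow>
     integrable M X \<and> integrable M (\<lambda>\<omega>. (X \<omega> - prob_space.expectation M X)\<^sup>2)"

end

theory Submission
  imports Defs
begin

text \<open>For independent terms the covariances vanish, so the variance of a weighted sum is the
  sum of the squared weights times the individual variances
  (\<open>variance_weighted_sum_indep_vars\<close>). Replacing each variance by the largest one
  leaves that maximum times the sum of the squared normalized weights, and this sum is the
  reciprocal of the effective sample size. The vanishing of covariances comes from the mean-zero
  case, \<open>indep_vars_sum_second_moment\<close>.\<close>

text \<open>Pythagoras for independent centered variables, by adding one variable at a time.
  Integrability is carried through the induction because splitting the expectation of the expanded
  square requires it for the previous partial sum.\<close>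

lemma (in prob_space) indep_vars_sum_second_moment:
  fixes Z :: "'i \<Rightarrow> 'a \<Rightarrow> real"
  assumes "finite I" and "indep_vars (\<lambda>_. borel) Z I"
    and "\<And>i. i \<in> I \<Longrightarrow> expectation (Z i) = 0"
    and "\<And>i. i \<in> I \<Longrightarrow> integrable M (\<lambda>\<omega>. (Z i \<omega>)\<^sup>2)"
  shows "integrable M (\<lambda>\<omega>. (\<Sum>i\<in>I. Z i \<omega>)\<^sup>2) \<and>
    expectation (\<lambda>\<omega>. (\<Sum>i\<in>I. Z i \<omega>)\<^sup>2) = (\<Sum>i\<in>I. expectation (\<lambda>\<omega>. (Z i \<omega>)\<^sup>2))"
  using assms
proof (induction I rule: finite_induct)
  case empty
  then show ?case by simp
next
  case (insert k F)
  let ?S = "\<lambda>\<omega>. \<Sum>i\<in>F. Z i \<omega>"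
  have meas: "Z i \<in> borel_measurable M" if "i \<in> insert k F" for i
    using conjunct1[OF insert.prems(1)[unfolded indep_vars_def2]] that by (rule bspec)
  have int: "integrable M (Z i)" if "i \<in> insert k F" for i
    using meas[OF that] insert.prems(3)[OF that] by (rule square_integrable_imp_integrable)
  have intS: "integrable M ?S"
    using int by auto
  have "indep_vars (\<lambda>_. borel) Z F"
    using insert.prems(1) by (rule indep_vars_subset) auto
  then have IH: "integrable M (\<lambda>\<omega>. (?S \<omega>)\<^sup>2)"
    "expectation (\<lambda>\<omega>. (?S \<omega>)\<^sup>2) = (\<Sum>i\<in>F. expectation (\<lambda>\<omega>. (Z i \<omega>)\<^sup>2))"
    using insert.IH insert.prems(2,3) by simp_all
  have indep: "indep_var borel (Z k) borel ?S"
    using insert.hyps insert.prems(1) by (intro indep_vars_sum) auto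
  have intk: "integrable M (Z k)" "integrable M (\<lambda>\<omega>. (Z k \<omega>)\<^sup>2)"
    using int insert.prems(3) by auto
  \<comment> \<open>Independence makes the product integrable and factors its expectation; the
    factor \<open>expectation (Z k)\<close> is zero.\<close>
  have cross: "integrable M (\<lambda>\<omega>. Z k \<omega> * ?S \<omega>)" "expectation (\<lambda>\<omega>. Z k \<omega> * ?S \<omega>) = 0"
    using indep_var_integrable[OF indep intk(1) intS]
      indep_var_lebesgue_integral[OF indep intk(1) intS] insert.prems(2)[of k] by simp_all
  have eq: "(\<Sum>i\<in>insert k F. Z i \<omega>)\<^sup>2 = (Z k \<omega>)\<^sup>2 + (?S \<omega>)\<^sup>2 + 2 * (Z k \<omega> * ?S \<omega>)" for \<omega>
    using insert.hyps by (simp add: power2_sum)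
  have "expectation (\<lambda>\<omega>. (Z k \<omega>)\<^sup>2 + (?S \<omega>)\<^sup>2 + 2 * (Z k \<omega> * ?S \<omega>))
      = expectation (\<lambda>\<omega>. (Z k \<omega>)\<^sup>2) + expectation (\<lambda>\<omega>. (?S \<omega>)\<^sup>2)
        + 2 * expectation (\<lambda>\<omega>. Z k \<omega> * ?S \<omega>)"
    using intk IH(1) cross(1) by simp
  moreover have "integrable M (\<lambda>\<omega>. (Z k \<omega>)\<^sup>2 + (?S \<omega>)\<^sup>2 + 2 * (Z k \<omega> * ?S \<omega>))"
    using intk IH(1) cross(1) by simp
  ultimately show ?case
    unfolding eq using IH(2) cross(2) insert.hyps by simp
qed

text \<open>Centering and scaling act on each variable separately, hence preserve independence, so
  the mean-zero case applies to the scaled deviations \<open>?Z i\<close>.\<close>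

lemma (in prob_space) variance_weighted_sum_indep_vars:
  fixes X :: "'i \<Rightarrow> 'a \<Rightarrow> real" and w :: "'i \<Rightarrow> real"
  assumes "finite I" and "indep_vars (\<lambda>_. borel) X I"
    and "\<And>i. i \<in> I \<Longrightarrow> integrable M (X i)"
    and "\<And>i. i \<in> I \<Longrightarrow> integrable M (\<lambda>\<omega>. (X i \<omega> - expectation (X i))\<^sup>2)"
  shows "variance (\<lambda>\<omega>. \<Sum>i\<in>I. w i * X i \<omega>) = (\<Sum>i\<in>I. (w i)\<^sup>2 * variance (X i))"
proof -
  let ?Z = "\<lambda>i \<omega>. w i * (X i \<omega> - expectation (X i))"
  have "indep_vars (\<lambda>_. borel) ?Z I"
    using assms(2) by (rule indep_vars_compose2) auto
  moreover have "expectation (?Z i) = 0" if "i \<in> I" for i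
    using assms(3)[OF that] by (simp add: prob_space)
  moreover have "integrable M (\<lambda>\<omega>. (?Z i \<omega>)\<^sup>2)" if "i \<in> I" for i
    using assms(4)[OF that] by (simp add: power_mult_distrib)
  ultimately have moments: "expectation (\<lambda>\<omega>. (\<Sum>i\<in>I. ?Z i \<omega>)\<^sup>2) = (\<Sum>i\<in>I. expectation (\<lambda>\<omega>. (?Z i \<omega>)\<^sup>2))"
    using indep_vars_sum_second_moment[OF assms(1), of ?Z] by blast
  have "expectation (\<lambda>\<omega>. \<Sum>i\<in>I. w i * X i \<omega>) = (\<Sum>i\<in>I. w i * expectation (X i))"
    using assms(3) by simp
  \<comment> \<open>By linearity of expectation, the deviation of the weighted sum is the weighted
    sum of the deviations.\<close>
  then have centered: "(\<Sum>i\<in>I. w i * X i \<omega>) - expectation (\<lambda>\<omega>. \<Sum>i\<in>I. w i * X i \<omega>) = (\<Sum>i\<in>I. ?Z i \<omega>)" for \<omega>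
    by (simp add: right_diff_distrib sum_subtractf)
  show ?thesis
    unfolding centered moments by (simp add: power_mult_distrib)
qed

theorem proposition2:
  fixes M :: "'w measure"  (* conditional law given the target label and the weights *)
    and N :: nat
    and y\<^sub>c :: 'y
    and a :: "nat \<Rightarrow> 'y \<Rightarrow> real"
    and l :: "nat \<Rightarrow> 'y \<Rightarrow> 'w \<Rightarrow> real"
  assumes "prob_space M"
    and "\<And>i. i \<in> {1..N} \<Longrightarrow> a i y\<^sub>c \<ge> 0"
    and "(\<Sum>i=1..N. a i y\<^sub>c) > 0"
    and "\<And>i. i \<in> {1..N} \<Longrightarrow> l i y\<^sub>c \<in> borel_measurable M"
    and "prob_space.indep_vars M (\<lambda>_. borel) (\<lambda>i. l i y\<^sub>c) {1..N}"
    and "\<And>i. i \<in> {1..N} \<Longrightarrow> has_finite_variance M (l i y\<^sub>c)"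
  shows "prob_space.variance M (weighted_loss N a l y\<^sub>c)
           \<le> (MAX i\<in>{1..N}. prob_space.variance M (l i y\<^sub>c)) / eff_sample_size N a y\<^sub>c"
proof -
  interpret prob_space M by fact
  let ?w = "vic_norm_weight N a y\<^sub>c" and ?V = "\<lambda>i. variance (l i y\<^sub>c)"
  have fin: "integrable M (l i y\<^sub>c)" "integrable M (\<lambda>\<omega>. (l i y\<^sub>c \<omega> - expectation (l i y\<^sub>c))\<^sup>2)"
    if "i \<in> {1..N}" for i
    using assms(6)[OF that] unfolding has_finite_variance_def by auto
  have "variance (weighted_loss N a l y\<^sub>c) = (\<Sum>i=1..N. (?w i)\<^sup>2 * ?V i)"
    unfolding weighted_loss_def
    using variance_weighted_sum_indep_vars[OF _ assms(5) fin, of ?w] by simp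
  \<comment> \<open>Squared weights are nonnegative, so each variance can be bounded by the maximum
    termwise.\<close>
  also have "\<dots> \<le> (\<Sum>i=1..N. (?w i)\<^sup>2 * (MAX i\<in>{1..N}. ?V i))"
    by (intro sum_mono mult_left_mono Max_ge) auto
  \<comment> \<open>The common maximum factors out, and dividing by \<open>1 / s\<close> is
    multiplying by \<open>s\<close>, where \<open>s\<close> is the sum of the squared
    weights.\<close>
  also have "\<dots> = (MAX i\<in>{1..N}. ?V i) / eff_sample_size N a y\<^sub>c"
    by (simp add: eff_sample_size_def sum_distrib_right[symmetric])
  finally show ?thesis .
qed

end
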